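(* Let $r>1$ be a fixed real number. Let $S_1$ and $S_2$ be sets of primes, and suppose that there are constants $\delta_1,\delta_2>0$ and $c>0$ such that for $j=1,2$ $$\pi_{S_j}(x):=\sum_{p\le x,\ p\in S_j}1=\frac{1}{\delta_j}\mathrm{Li}(x)+\mathcal{O}\left(xe^{-c\sqrt{\log x}}\right).$$ Put $D_r(x):=\#\{pq\le x:\ p<q\le rp,\ p\in S_1,\ q\in S_2\}$, where $p,q$ denote primes, and for $x\ge 2r$ put $$F_r(x)=\int_{2r}^x\frac{\log\log\sqrt{rt}-\log\log\sqrt{t/r}}{\log t}\,dt.$$ Let $0<\epsilon<1$ be arbitrary and $c(\epsilon)=(1-\epsilon)c/\sqrt{2}$. Then for $x\ge 2r$, as $x$ tends to infinity, $$\delta_1\delta_2D_r(x)=F_r(x)+\mathcal{O}\left(rxe^{-c(\epsilon)\sqrt{\log x}}\right).$$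
   Context: $\mathrm{Li}(x)=\int_2^x\frac{dt}{\log t}$ is the logarithmic integral. Throughout, $p$ and $q$ denote primes. The implied constant in the error term may depend on the sets $S_1,S_2$ (and on $\epsilon$). *)

theory Defs
  imports
    "HOL-Analysis.Analysis"
    "HOL-Library.Landau_Symbols"
    "HOL-Computational_Algebra.Primes"
begin

definition Li :: "real \<Rightarrow> real" where
  "Li x = integral {2..x} (\<lambda>t. 1 / ln t)"

definition prime_count :: "nat set \<Rightarrow> real \<Rightarrow> nat" where
  "prime_count S x = card {p. prime p \<and> real p \<le> x \<and> p \<in> S}"

text \<open>The elements counted are the integers $n = pq$; since $p < q$, each of them determines the
  pair $(p, q)$.\<close>

definition D :: "nat set \<Rightarrow> nat set \<Rightarrow> real \<Rightarrow> real \<Rightarrow> nat" where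
  "D S1 S2 r x = card {p * q | p q. prime p \<and> prime q \<and> real (p * q) \<le> x \<and>
     p < q \<and> real q \<le> r * real p \<and> p \<in> S1 \<and> q \<in> S2}"

definition F :: "real \<Rightarrow> real \<Rightarrow> real" where
  "F r x = integral {2 * r..x}
     (\<lambda>t. (ln (ln (sqrt (r * t))) - ln (ln (sqrt (t / r)))) / ln t)"

end

theory Submission
  imports Defs
begin

text \<open>
  Write \<open>g y = y exp (- c sqrt (ln y))\<close>. This function is increasing up to the factor
  \<open>exp (c\<^sup>2 / 4)\<close>, so the errors in both prime counts at any \<open>y \<le> Y\<close> are \<open>O(g Y)\<close>.
  Summing over \<open>p \<in> S1\<close>, \<open>p \<le> sqrt x\<close>, the number of admissible \<open>q\<close> is a difference of values of
  the counting function of \<open>S2\<close> at arguments at most \<open>sqrt (r x)\<close>; replacing it by \<open>Li\<close> costs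
  \<open>O(sqrt x g (sqrt (r x)))\<close>. Writing the differences of \<open>Li\<close> as integrals over \<open>u\<close> and exchanging sum
  and integral produces the counting function of \<open>S1\<close> at arguments at most \<open>sqrt x\<close>; replacing
  this by \<open>Li\<close> costs \<open>O(sqrt (r x) g (sqrt x))\<close>. What remains is the integral of
  \<open>1 / (ln u ln v)\<close> over \<open>2 \<le> v \<le> u \<le> r v\<close>, \<open>u v \<le> x\<close>. In the coordinates \<open>u\<close> and \<open>t = u v\<close>
  the integral over \<open>u\<close> is elementary and, for \<open>t \<ge> 4 r\<close>, equals the integrand of \<open>F\<close>.
  Since \<open>sqrt x g (sqrt x) = x exp (- (c / sqrt 2) sqrt (ln x))\<close>, all errors have the claimed size,
  uniformly in \<open>r\<close>; for \<open>x < 4 r\<close> the trivial bounds suffice.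
\<close>

section \<open>The logarithmic integral: increments and continuity\<close>

lemma ln_inverse_integrable:
  fixes a b :: real
  assumes "1 < a"
  shows "(\<lambda>t. 1 / ln t) integrable_on {a..b}"
  using assms by (intro integrable_continuous_real continuous_intros) auto

text \<open>Left of 2 the integral defining \<open>Li\<close> runs over an empty interval and
  vanishes, so an increment only sees the part of \<open>{a..b}\<close> from 2 on. This keeps the
  pole of \<open>1 / ln t\<close> at 1 away and admits arguments such as \<open>u / r\<close> below
  2.\<close>

lemma Li_diff:
  assumes "a \<le> b"
  shows "Li b - Li a = integral {max 2 a..b} (\<lambda>t. 1 / ln t)"
proof -
  have z: "Li y = 0" if "y \<le> 2" for y
    using that by (cases "y = 2") (auto simp: Li_def)
  consider "b \<le> 2" | "a \<le> 2" "2 \<le> b" | "2 \<le> a" by linarith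
  then show ?thesis
  proof cases
    case 1
    then have "max 2 a = 2" using assms by simp
    then show ?thesis using z[of a] 1 assms by (simp add: Li_def)
  next
    case 2
    then show ?thesis using z[of a] by (simp add: Li_def max_def)
  next
    case 3
    have "integral {2..a} (\<lambda>t. 1 / ln t) + integral {a..b} (\<lambda>t. 1 / ln t)
        = integral {2..b} (\<lambda>t. 1 / ln t)"
      using 3 assms
      by (intro Henstock_Kurzweil_Integration.integral_combine ln_inverse_integrable) auto
    then show ?thesis using 3 by (simp add: Li_def max_def)
  qed
qed

lemma Li_diff_bounds:
  assumes "a \<le> b"
  shows "0 \<le> Li b - Li a" "Li b - Li a \<le> (b - a) / ln 2"
proof -
  have ln: "1 / ln t \<le> 1 / ln 2" "0 \<le> 1 / ln t" if "2 \<le> t" for t :: real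
    using that by (auto intro!: divide_left_mono mult_pos_pos)
  show "0 \<le> Li b - Li a"
    unfolding Li_diff[OF assms] using ln
    by (intro Henstock_Kurzweil_Integration.integral_nonneg ln_inverse_integrable) auto
  have "Li b - Li a \<le> integral {max 2 a..b} (\<lambda>t. 1 / ln 2)"
    unfolding Li_diff[OF assms] using ln
    by (intro integral_le ln_inverse_integrable) auto
  also have "\<dots> = max 0 (b - max 2 a) / ln 2"
    by (auto simp: max_def)
  also have "\<dots> \<le> (b - a) / ln 2"
    using assms by (intro divide_right_mono) auto
  finally show "Li b - Li a \<le> (b - a) / ln 2" .
qed

text \<open>The bounds on increments make \<open>Li\<close> Lipschitz with constant
  \<open>1 / ln 2\<close> on the whole line.\<close>

lemma continuous_on_Li: "continuous_on A Li"
proof -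
  have "\<bar>Li x - Li y\<bar> \<le> 1 / ln 2 * \<bar>x - y\<bar>" for x y
    using Li_diff_bounds[of x y] Li_diff_bounds[of y x] by (cases "x \<le> y") auto
  then have "(1 / ln 2)-lipschitz_on A Li"
    by (intro lipschitz_onI) (auto simp: dist_real_def)
  then show ?thesis by (rule lipschitz_on_continuous_on)
qed

lemma Li_bounds:
  assumes "0 \<le> y"
  shows "0 \<le> Li y" "Li y \<le> y / ln 2"
  using Li_diff_bounds[of 0 y] assms by (auto simp: Li_def)

section \<open>Trivial bounds for counting functions\<close>

lemma finite_real_le: "finite {p::nat. real p \<le> x \<and> P p}"
  by (rule finite_subset[of _ "{..nat \<lfloor>x\<rfloor>}"]) (auto simp: le_nat_floor)

text \<open>With 0 excluded there are at most \<open>nat \<lfloor>x\<rfloor>\<close> candidates, so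
  the bound is \<open>x\<close> and not \<open>x + 1\<close>.\<close>

lemma card_pos_real_le:
  assumes "0 \<le> x" and "A \<subseteq> {p::nat. 0 < p \<and> real p \<le> x}"
  shows "real (card A) \<le> x"
proof -
  have "card A \<le> card {1..nat \<lfloor>x\<rfloor>}"
    using assms by (intro card_mono) (auto simp: le_nat_floor subset_iff Suc_le_eq)
  then show ?thesis using assms(1)
    by simp (metis of_nat_floor of_nat_le_iff order_trans)
qed

lemma prime_count_le:
  assumes "0 \<le> y"
  shows "real (prime_count S y) \<le> y"
  unfolding prime_count_def using assms by (intro card_pos_real_le) (auto simp: prime_gt_0_nat)

section \<open>Uniform error bounds for the prime counts\<close>

text \<open>With \<open>u = sqrt (ln y)\<close> the left side is
  \<open>exp (u\<^sup>2 - c * u)\<close>. For \<open>u \<ge> 0\<close> this parabola is at most 0 up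
  to \<open>c\<close>, increases from \<open>c\<close> on, and is never below
  \<open>- c\<^sup>2 / 4\<close>.\<close>

lemma error_term_quasi_mono:
  fixes c y Y :: real
  assumes "1 \<le> y" "y \<le> Y"
  shows "y * exp (- c * sqrt (ln y)) \<le> exp (c\<^sup>2 / 4) * (Y * exp (- c * sqrt (ln Y)))"
proof -
  define u U where "u = sqrt (ln y)" and "U = sqrt (ln Y)"
  have u: "0 \<le> u" "u \<le> U" "u\<^sup>2 = ln y" "U\<^sup>2 = ln Y"
    using assms by (auto simp: u_def U_def)
  have "u * (u - c) \<le> U * (U - c) \<or> u * (u - c) \<le> 0"
    using u by (cases "u \<le> c") (auto intro!: mult_mono mult_nonneg_nonpos)
  then have "u\<^sup>2 - c * u \<le> U\<^sup>2 - c * U \<or> u\<^sup>2 - c * u \<le> 0"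
    by (auto simp: power2_eq_square algebra_simps)
  moreover have "0 \<le> c\<^sup>2 / 4 + (U\<^sup>2 - c * U)"
    using zero_le_power2[of "U - c / 2"] by (simp add: power2_eq_square algebra_simps)
  ultimately have "u\<^sup>2 - c * u \<le> c\<^sup>2 / 4 + (U\<^sup>2 - c * U)"
    using zero_le_power2[of c] by linarith
  then have "exp (u\<^sup>2 - c * u) \<le> exp (c\<^sup>2 / 4 + (U\<^sup>2 - c * U))" by simp
  moreover have "exp (u\<^sup>2 - c * u) = y * exp (- c * sqrt (ln y))"
    using assms u by (simp add: exp_diff exp_minus field_simps flip: u_def)
  moreover have "exp (c\<^sup>2 / 4 + (U\<^sup>2 - c * U)) = exp (c\<^sup>2 / 4) * (Y * exp (- c * sqrt (ln Y)))"
    unfolding exp_add exp_diff using assms u by (simp add: exp_minus field_simps flip: U_def)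
  ultimately show ?thesis by simp
qed

text \<open>Above a threshold \<open>N\<close> the Landau bound applies at \<open>y\<close>, and
  quasi-monotonicity moves it to \<open>Y\<close>. Below \<open>N\<close> the linear bound gives the
  constant \<open>L * N\<close>, which a multiple of the error term at \<open>Y\<close> dominates.
  One constant thus serves all \<open>y\<close>, including small ones.\<close>

lemma error_uniform_bound:
  fixes f :: "real \<Rightarrow> real"
  assumes O: "f \<in> O[at_top](\<lambda>x. x * exp (- c * sqrt (ln x)))"
    and lin: "\<And>y. 0 \<le> y \<Longrightarrow> \<bar>f y\<bar> \<le> L * y"
  obtains C where "0 \<le> C"
    "\<And>y Y. 0 \<le> y \<Longrightarrow> y \<le> Y \<Longrightarrow> 1 \<le> Y \<Longrightarrow> \<bar>f y\<bar> \<le> C * (Y * exp (- c * sqrt (ln Y)))"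
proof -
  obtain K where K: "K > 0" "eventually (\<lambda>x. norm (f x) \<le> K * norm (x * exp (- c * sqrt (ln x)))) at_top"
    using O by (elim landau_o.bigE) auto
  then obtain N0 where N0: "\<And>x. x \<ge> N0 \<Longrightarrow> \<bar>f x\<bar> \<le> K * \<bar>x * exp (- c * sqrt (ln x))\<bar>"
    by (auto simp: eventually_at_top_linorder)
  define N where "N = max 1 N0"
  have "0 \<le> L" using lin[of 1] by auto
  define A where "A = exp (c\<^sup>2 / 4)"
  have A: "A > 0" by (simp add: A_def)
  let ?g = "\<lambda>Y. Y * exp (- c * sqrt (ln Y))"
  show ?thesis
  proof (rule that[of "K * A + L * N * A"])
    show "0 \<le> K * A + L * N * A" using K A \<open>0 \<le> L\<close> by (auto simp: N_def)
    fix y Y :: real assume y: "0 \<le> y" "y \<le> Y" "1 \<le> Y"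
    show "\<bar>f y\<bar> \<le> (K * A + L * N * A) * ?g Y"
    proof (cases "y \<ge> N")
      case True
      then have "\<bar>f y\<bar> \<le> K * ?g y" using N0[of y] by (simp add: N_def abs_mult)
      also have "\<dots> \<le> K * (A * ?g Y)"
        using K(1) y True unfolding A_def
        by (intro mult_left_mono error_term_quasi_mono) (auto simp: N_def)
      also have "\<dots> \<le> (K * A + L * N * A) * ?g Y"
        using A y \<open>0 \<le> L\<close> by (auto simp: algebra_simps N_def)
      finally show ?thesis .
    next
      case False
      have "\<bar>f y\<bar> \<le> L * N * 1"
        using lin[OF y(1)] False \<open>0 \<le> L\<close> mult_left_mono[of y N L] by linarith
      \<comment> \<open>The error term equals 1 at the argument 1, so quasi-monotonicity from there
        gives \<open>1 \<le> A * ?g Y\<close>.\<close>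
      also have "\<dots> \<le> L * N * (A * ?g Y)"
        using error_term_quasi_mono[of 1 Y c] y \<open>0 \<le> L\<close> unfolding A_def
        by (intro mult_left_mono) (auto simp: N_def)
      also have "\<dots> \<le> (K * A + L * N * A) * ?g Y"
        using A y K(1) by (auto simp: algebra_simps)
      finally show ?thesis .
    qed
  qed
qed

text \<open>Multiplication by \<open>\<delta>\<close> gives \<open>Li\<close> the coefficient 1. The
  linear bound needed for small arguments comes from \<open>prime_count S y \<le> y\<close> and
  \<open>Li y \<le> y / ln 2\<close>.\<close>

lemma prime_count_uniform_bound:
  assumes O: "(\<lambda>x. real (prime_count S x) - 1 / \<delta> * Li x) \<in> O[at_top](\<lambda>x. x * exp (- c * sqrt (ln x)))"
    and "\<delta> > 0"
  obtains C where "0 \<le> C"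
    "\<And>y Y. 0 \<le> y \<Longrightarrow> y \<le> Y \<Longrightarrow> 1 \<le> Y \<Longrightarrow>
       \<bar>\<delta> * real (prime_count S y) - Li y\<bar> \<le> C * (Y * exp (- c * sqrt (ln Y)))"
proof -
  have lin: "\<bar>real (prime_count S y) - 1 / \<delta> * Li y\<bar> \<le> (1 + 1 / \<delta> / ln 2) * y" if "0 \<le> y" for y
  proof -
    have "0 \<le> 1 / \<delta> * Li y"
      using Li_bounds[OF that] \<open>\<delta> > 0\<close> by simp
    moreover have "1 / \<delta> * Li y \<le> 1 / \<delta> * (y / ln 2)"
      using Li_bounds[OF that] \<open>\<delta> > 0\<close> by (intro mult_left_mono) auto
    ultimately show ?thesis using prime_count_le[OF that, of S] by (auto simp: algebra_simps)
  qed
  obtain C where C: "0 \<le> C"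
    "\<And>y Y. 0 \<le> y \<Longrightarrow> y \<le> Y \<Longrightarrow> 1 \<le> Y \<Longrightarrow>
       \<bar>real (prime_count S y) - 1 / \<delta> * Li y\<bar> \<le> C * (Y * exp (- c * sqrt (ln Y)))"
    using error_uniform_bound[OF O lin] by metis
  show ?thesis
  proof (rule that[of "\<delta> * C"])
    show "0 \<le> \<delta> * C" using C \<open>\<delta> > 0\<close> by simp
    fix y Y :: real assume y: "0 \<le> y" "y \<le> Y" "1 \<le> Y"
    have "\<delta> * \<bar>real (prime_count S y) - 1 / \<delta> * Li y\<bar> \<le> \<delta> * (C * (Y * exp (- c * sqrt (ln Y))))"
      using C(2)[OF y] \<open>\<delta> > 0\<close> by (intro mult_left_mono) auto
    moreover have "\<delta> * \<bar>real (prime_count S y) - 1 / \<delta> * Li y\<bar> = \<bar>\<delta> * real (prime_count S y) - Li y\<bar>"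
      using \<open>\<delta> > 0\<close> by (simp add: abs_mult_pos' right_diff_distrib)
    ultimately show "\<bar>\<delta> * real (prime_count S y) - Li y\<bar> \<le> \<delta> * C * (Y * exp (- c * sqrt (ln Y)))"
      by (simp add: mult.assoc)
  qed
qed

section \<open>Counting: \<open>D\<close> as a sum over the smaller prime, and the exchange of sum
  and integral\<close>

lemma prime_mult_eq_imp_eq:
  fixes p q p' q' :: nat
  assumes "prime p" "prime q" "prime p'" "prime q'" "p < q" "p' < q'" "p * q = p' * q'"
  shows "p = p' \<and> q = q'"
proof -
  have "p dvd p' * q'" "q dvd p' * q'" using assms(7) by (metis dvd_triv_left, metis dvd_triv_right)
  then have "p = p' \<or> p = q'" "q = p' \<or> q = q'"
    using assms by (metis prime_dvd_mult_iff primes_dvd_imp_eq)+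
  \<comment> \<open>Of the four combinations, \<open>p = q'\<close> with \<open>q = p'\<close>
    contradicts the two orderings, and two others would give \<open>p = q\<close>.\<close>
  then show ?thesis using assms by auto
qed

text \<open>For fixed \<open>p\<close> the admissible \<open>q\<close> satisfy
  \<open>p < q \<le> min (r * p) (x / p)\<close>, which gives a difference of two prime counts.
  Since \<open>p < q\<close> and \<open>p * q \<le> x\<close> force \<open>p \<le> sqrt x\<close>,
  the sum may stop there.\<close>

lemma D_eq_sum_prime_count:
  assumes "1 < r" "0 \<le> x"
  shows "real (D S1 S2 r x) = (\<Sum>p | real p \<le> sqrt x \<and> prime p \<and> p \<in> S1.
    real (prime_count S2 (min (r * real p) (x / real p))) - real (prime_count S2 (real p)))"
proof -
  define P where "P = {p. real p \<le> sqrt x \<and> prime p \<and> p \<in> S1}"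
  define m where "m p = min (r * real p) (x / real p)" for p :: nat
  define Q where "Q p = {q. real q \<le> m p \<and> (prime q \<and> q \<in> S2 \<and> p < q)}" for p :: nat
  have fP: "finite P" unfolding P_def by (rule finite_real_le)
  have fQ: "finite (Q p)" for p unfolding Q_def by (rule finite_real_le)
  have sq: "real p \<le> sqrt x" if "p < q" "real p * real q \<le> x" for p q :: nat
  proof (rule real_le_rsqrt)
    have "(real p)\<^sup>2 \<le> real p * real q"
      using that unfolding power2_eq_square by (intro mult_left_mono) auto
    then show "(real p)\<^sup>2 \<le> x" using that by simp
  qed
  have iff: "prime p \<and> prime q \<and> real (p * q) \<le> x \<and> p < q \<and> real q \<le> r * real p \<and> p \<in> S1 \<and> q \<in> S2
      \<longleftrightarrow> p \<in> P \<and> q \<in> Q p" for p q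
  proof (cases "prime p")
    case True
    then have "real (p * q) \<le> x \<longleftrightarrow> real q \<le> x / real p"
      using prime_gt_0_nat[of p] by (simp add: pos_le_divide_eq mult.commute)
    then show ?thesis using True sq[of p q] by (auto simp: P_def Q_def m_def)
  qed (simp add: P_def)
  have "{p * q | p q. prime p \<and> prime q \<and> real (p * q) \<le> x \<and>
     p < q \<and> real q \<le> r * real p \<and> p \<in> S1 \<and> q \<in> S2} = (\<lambda>(p, q). p * q) ` (SIGMA p:P. Q p)"
    unfolding iff by (auto simp: image_iff)
  \<comment> \<open>\<open>D\<close> counts products, so passing to pairs needs unique
    factorisation.\<close>
  moreover have "inj_on (\<lambda>(p, q). p * q) (SIGMA p:P. Q p)"
  proof (rule inj_onI, clarify)
    fix p q p' q'
    assume "p \<in> P" "q \<in> Q p" "p' \<in> P" "q' \<in> Q p'" "p * q = p' * q'"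
    then show "p = p' \<and> q = q'"
      by (intro prime_mult_eq_imp_eq) (auto simp: P_def Q_def)
  qed
  ultimately have "D S1 S2 r x = card (SIGMA p:P. Q p)"
    unfolding D_def by (simp add: card_image)
  also have "\<dots> = (\<Sum>p\<in>P. card (Q p))"
    using fP fQ by simp
  finally have "real (D S1 S2 r x) = (\<Sum>p\<in>P. real (card (Q p)))" by simp
  also have "\<dots> = (\<Sum>p\<in>P. real (prime_count S2 (m p)) - real (prime_count S2 (real p)))"
  proof (rule sum.cong[OF refl])
    fix p assume "p \<in> P"
    then have p: "0 < real p" "real p \<le> sqrt x" by (auto simp: P_def prime_gt_0_nat)
    then have "real p * real p \<le> sqrt x * sqrt x" using assms by (intro mult_mono) auto
    \<comment> \<open>Hence the primes up to \<open>p\<close> are among those up to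
      \<open>m p\<close>, and subtracting their number leaves exactly the count of
      \<open>Q p\<close>.\<close>
    then have "real p \<le> m p" using p assms by (auto simp: m_def field_simps)
    then have "{q. prime q \<and> real q \<le> m p \<and> q \<in> S2}
        = Q p \<union> {q. prime q \<and> real q \<le> real p \<and> q \<in> S2}"
      by (auto simp: Q_def)
    moreover have "card (Q p \<union> {q. prime q \<and> real q \<le> real p \<and> q \<in> S2})
        = card (Q p) + card {q. prime q \<and> real q \<le> real p \<and> q \<in> S2}"
      using fQ by (intro card_Un_disjoint) (auto simp: Q_def)
    ultimately show "real (card (Q p)) = real (prime_count S2 (m p)) - real (prime_count S2 (real p))"
      unfolding prime_count_def by simp
  qed
  finally show ?thesis by (simp only: P_def m_def)
qed

lemma D_le:
  assumes "0 \<le> x"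
  shows "real (D S1 S2 r x) \<le> x"
  unfolding D_def using assms
  by (intro card_pos_real_le) (auto simp: prime_gt_0_nat)

text \<open>The error \<open>1\<close> accounts for the boundary case \<open>p = u / r\<close>.\<close>
lemma card_window:
  assumes "1 < r" "0 < x" "0 < u" "u \<le> sqrt (r * x)"
  shows "\<bar>real (card {p \<in> {p. real p \<le> sqrt x \<and> prime p \<and> p \<in> S}.
      real p \<le> u \<and> u \<le> min (r * real p) (x / real p)})
    - (real (prime_count S (min u (x / u))) - real (prime_count S (u / r)))\<bar> \<le> 1"
proof -
  define A where "A = {p \<in> {p. real p \<le> sqrt x \<and> prime p \<and> p \<in> S}.
      real p \<le> u \<and> u \<le> min (r * real p) (x / real p)}"
  define B where "B = {p. real p \<le> min u (x / u) \<and> (prime p \<and> p \<in> S)}"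
  define L where "L = {p. real p \<le> u / r \<and> (prime p \<and> p \<in> S)}"
  have sq: "real p \<le> sqrt x" if "real p \<le> u" "real p * u \<le> x" for p :: nat
  proof (rule real_le_rsqrt)
    have "(real p)\<^sup>2 \<le> real p * u"
      using that unfolding power2_eq_square by (intro mult_left_mono) auto
    then show "(real p)\<^sup>2 \<le> x" using that by simp
  qed
  have "u * u \<le> sqrt (r * x) * sqrt (r * x)" using assms by (intro mult_mono) auto
  then have u: "u / r \<le> x / u" "u / r \<le> u" using assms by (auto simp: field_simps)
  \<comment> \<open>Solved for \<open>p\<close>, the bound
    \<open>u \<le> min (r * p) (x / p)\<close> reads \<open>u / r \<le> p \<le> x / u\<close>; the
    condition \<open>p \<le> sqrt x\<close> follows from \<open>p \<le> u\<close> and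
    \<open>p \<le> x / u\<close>.\<close>
  have "A = {p \<in> B. u / r \<le> real p}"
    using sq assms by (auto simp: A_def B_def field_simps prime_gt_0_nat)
  then have BA: "B - L \<subseteq> A" "A \<subseteq> (B - L) \<union> {p. real p = u / r}" by (auto simp: L_def B_def)
  have LB: "L \<subseteq> B" using u by (auto simp: L_def B_def)
  have fin: "finite B" "finite L" "finite A"
    unfolding B_def L_def A_def by (auto intro: finite_real_le finite_subset[OF _ finite_real_le])
  have sing: "card {p. real p = u / r} \<le> 1" "finite {p. real p = u / r}"
  proof -
    have "{p. real p = u / r} \<subseteq> {nat \<lfloor>u / r\<rfloor>}" by auto (metis floor_of_nat nat_int)
    then show "card {p. real p = u / r} \<le> 1" "finite {p. real p = u / r}"
      using card_mono[of "{nat \<lfloor>u / r\<rfloor>}" "{p. real p = u / r}"] finite_subset by auto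
  qed
  have "card (B - L) \<le> card A" using BA fin by (intro card_mono) auto
  moreover have "card A \<le> card ((B - L) \<union> {p. real p = u / r})"
    using BA fin sing by (intro card_mono) auto
  moreover have "\<dots> \<le> card (B - L) + 1"
    using card_Un_le[of "B - L" "{p. real p = u / r}"] sing by linarith
  moreover have "card (B - L) = card B - card L" "card L \<le> card B"
    using LB fin by (auto simp: card_Diff_subset card_mono)
  moreover have "prime_count S (min u (x / u)) = card B" "prime_count S (u / r) = card L"
    unfolding prime_count_def B_def L_def by (auto intro!: arg_cong[where f = card])
  ultimately show ?thesis unfolding A_def[symmetric] by auto
qed

text \<open>Each increment is the integral of \<open>1 / ln u\<close> over \<open>{p..m p}\<close>,
  and all these intervals lie in \<open>{2..sqrt (r * x)}\<close>. Summing over \<open>p\<close>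
  under the integral leaves at each \<open>u\<close> the number of intervals containing it, which
  \<open>card_window\<close> estimates.\<close>

lemma sum_Li_eq_integral:
  fixes S :: "nat set" and r x :: real
  assumes "1 < r" "0 < x"
  defines "P \<equiv> {p. real p \<le> sqrt x \<and> prime p \<and> p \<in> S}"
    and "m \<equiv> \<lambda>p::nat. min (r * real p) (x / real p)"
  shows "((\<lambda>u. real (card {p\<in>P. real p \<le> u \<and> u \<le> m p}) / ln u) has_integral
           (\<Sum>p\<in>P. Li (m p) - Li (real p))) {2..sqrt (r * x)}"
proof -
  have fP: "finite P" unfolding P_def by (rule finite_real_le)
  have "((\<lambda>u. \<Sum>p\<in>P. if u \<in> {real p..m p} then 1 / ln u else 0) has_integral
           (\<Sum>p\<in>P. Li (m p) - Li (real p))) {2..sqrt (r * x)}"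
  proof (intro has_integral_sum fP)
    fix p assume "p \<in> P"
    then have p: "2 \<le> real p" "real p \<le> sqrt x" using prime_ge_2_nat by (auto simp: P_def)
    then have "real p * real p \<le> sqrt x * sqrt x" using assms by (intro mult_mono) auto
    then have pm: "real p \<le> m p" using p assms by (auto simp: m_def field_simps)
    \<comment> \<open>The two arguments of the minimum \<open>m p\<close> have product
      \<open>r * x\<close>.\<close>
    have "m p \<le> sqrt (r * x)"
    proof (rule real_le_rsqrt)
      have "m p * m p \<le> (r * real p) * (x / real p)"
        using p assms pm by (intro mult_mono) (auto simp: m_def)
      then show "(m p)\<^sup>2 \<le> r * x" using p by (simp add: power2_eq_square)
    qed
    then have sub: "{real p..m p} \<inter> {2..sqrt (r * x)} = {real p..m p}" using p by auto
    have "((\<lambda>t. 1 / ln t) has_integral Li (m p) - Li (real p)) {real p..m p}"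
      using Li_diff[OF pm] p ln_inverse_integrable[of "real p" "m p"]
      by (simp add: has_integral_integral max_def)
    then show "((\<lambda>u. if u \<in> {real p..m p} then 1 / ln u else 0) has_integral
        Li (m p) - Li (real p)) {2..sqrt (r * x)}"
      using has_integral_restrict_Int[of "{real p..m p}" "\<lambda>t. 1 / ln t" "Li (m p) - Li (real p)" "{2..sqrt (r * x)}"]
      unfolding sub by blast
  qed
  moreover have "(\<Sum>p\<in>P. if u \<in> {real p..m p} then 1 / ln u else 0)
      = real (card {p\<in>P. real p \<le> u \<and> u \<le> m p}) / ln u" for u
    using fP by (simp add: sum.If_cases Int_def)
  ultimately show ?thesis by simp
qed

section \<open>Bounds for the integrand of \<open>F\<close>\<close>

definition F_integrand :: "real \<Rightarrow> real \<Rightarrow> real" where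
  "F_integrand r t = (ln (ln (sqrt (r * t))) - ln (ln (sqrt (t / r)))) / ln t"

text \<open>A bound independent of \<open>r\<close> and \<open>t\<close>: the 1 comes from
  \<open>ln (ln (sqrt (r * t))) \<le> ln t\<close>, the rest from
  \<open>ln (ln (sqrt (t / r))) \<ge> ln (ln (sqrt 2))\<close>.\<close>

definition F_integrand_bound :: real where
  "F_integrand_bound = 1 - ln (ln (sqrt 2)) / ln 2"

text \<open>The hypothesis \<open>2 * r \<le> t\<close> gives \<open>2 \<le> t / r\<close>, which
  keeps the inner logarithms away from 0, and \<open>r \<le> t\<close>, which gives
  \<open>sqrt (r * t) \<le> t\<close>.\<close>

lemma F_integrand_bounds:
  assumes "1 < r" "2 * r \<le> t"
  shows "0 \<le> F_integrand r t" "F_integrand r t \<le> F_integrand_bound"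
proof -
  have t: "2 < t" "2 \<le> t / r" "r \<le> t" using assms by (auto simp: field_simps)
  have lt: "ln 2 \<le> ln t" "0 < ln t" using t by auto
  have "1 < sqrt (2::real)" by simp
  then have l2: "0 < ln (sqrt 2)" by (simp only: ln_gt_zero)
  have "sqrt 2 \<le> sqrt (t / r)" using t by simp
  then have a: "ln (sqrt 2) \<le> ln (sqrt (t / r))" by (subst ln_le_cancel_iff) (use t assms in auto)
  have "t * 1 \<le> t * (r * r)" using assms t mult_mono[of 1 r 1 r] by (intro mult_left_mono) auto
  then have "t / r \<le> r * t" using assms by (simp add: field_simps)
  then have b: "ln (sqrt (t / r)) \<le> ln (sqrt (r * t))" using t assms by (subst ln_le_cancel_iff) auto
  have "r * t \<le> t * t" using t by (intro mult_right_mono) auto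
  then have "sqrt (r * t) \<le> t" using t by (intro real_le_lsqrt) (auto simp: power2_eq_square)
  then have c: "ln (sqrt (r * t)) \<le> ln t" using t assms by (subst ln_le_cancel_iff) auto
  have pos: "0 < ln (sqrt (t / r))" "0 < ln (sqrt (r * t))" using a b l2 by linarith+
  have "ln (ln (sqrt (r * t))) \<le> ln (ln t)" using c pos lt by (subst ln_le_cancel_iff) auto
  also have "\<dots> \<le> ln t" using ln_bound[of "ln t"] lt by simp
  finally have d: "ln (ln (sqrt (r * t))) \<le> ln t" .
  have e: "ln (ln (sqrt 2)) \<le> ln (ln (sqrt (t / r)))" by (subst ln_le_cancel_iff) (fact l2 pos a)+
  have g: "ln (ln (sqrt (t / r))) \<le> ln (ln (sqrt (r * t)))" using b pos by (subst ln_le_cancel_iff) auto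
  show "0 \<le> F_integrand r t" unfolding F_integrand_def using g lt by simp
  have "ln (sqrt 2) = ln 2 / (2::real)" by (simp add: ln_sqrt)
  also have "\<dots> \<le> 1" using ln_bound[of "2::real"] by simp
  \<comment> \<open>This sign allows the denominator \<open>ln t\<close> to be replaced by the
    smaller \<open>ln 2\<close>.\<close>
  finally have n: "ln (ln (sqrt 2)) \<le> 0" using l2 by simp
  have "F_integrand r t \<le> (ln t + - ln (ln (sqrt 2))) / ln t"
    unfolding F_integrand_def using d e lt by (intro divide_right_mono) auto
  also have "\<dots> = 1 + (- ln (ln (sqrt 2))) / ln t" using lt by (simp add: field_simps)
  also have "\<dots> \<le> 1 + (- ln (ln (sqrt 2))) / ln 2"
    using n lt by (intro add_left_mono divide_left_mono) auto
  finally show "F_integrand r t \<le> F_integrand_bound" by (simp add: F_integrand_bound_def)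
qed

lemma F_integrand_integrable:
  assumes "1 < r" "2 * r \<le> a"
  shows "F_integrand r integrable_on {a..b}"
proof -
  have pos: "0 < ln (sqrt (r * t))" "0 < ln (sqrt (t / r))" "0 < ln t"
    if "t \<in> {a..b}" for t
  proof -
    have t: "1 < t" "1 < t / r" using assms that by (auto simp: field_simps)
    moreover have "1 < r * t" using t assms by (simp add: less_1_mult)
    ultimately show "0 < ln (sqrt (r * t))" "0 < ln (sqrt (t / r))" "0 < ln t"
      by (auto intro!: ln_gt_zero simp only: real_sqrt_gt_1_iff)
  qed
  have nz: "sqrt (r * t) \<noteq> 0" "sqrt (t / r) \<noteq> 0" if "t \<in> {a..b}" for t
    using assms that by auto
  show ?thesis
    unfolding F_integrand_def
    by (intro integrable_continuous_real continuous_intros ballI;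
        (rule nz pos[THEN less_imp_neq, symmetric])?; (assumption | use assms in force))
qed

lemma F_eq: "F r x = integral {2 * r..x} (F_integrand r)"
  unfolding F_def F_integrand_def ..

lemma F_integrand_integral_bounds:
  assumes "1 < r" "2 * r \<le> a" "a \<le> b"
  shows "0 \<le> integral {a..b} (F_integrand r)"
    "integral {a..b} (F_integrand r) \<le> F_integrand_bound * (b - a)"
proof -
  show "0 \<le> integral {a..b} (F_integrand r)"
    using F_integrand_bounds[of r] assms
    by (intro Henstock_Kurzweil_Integration.integral_nonneg F_integrand_integrable) auto
  have "integral {a..b} (F_integrand r) \<le> integral {a..b} (\<lambda>_. F_integrand_bound)"
    using F_integrand_bounds[of r] assms by (intro integral_le F_integrand_integrable) auto
  then show "integral {a..b} (F_integrand r) \<le> F_integrand_bound * (b - a)"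
    using assms by (simp add: mult.commute)
qed

section \<open>The main term as a double integral, evaluated in two coordinate systems\<close>

text \<open>The double integral of \<open>1 / (ln u ln v)\<close> over
  \<open>2 \<le> v \<le> u \<le> r v\<close>, \<open>u v \<le> x\<close>, with the integration over
  \<open>v\<close> from \<open>max 2 (u / r)\<close> to \<open>min u (x / u)\<close> already carried
  out.\<close>

definition main_integral :: "real \<Rightarrow> real \<Rightarrow> real" where
  "main_integral r x = integral {2..sqrt (r * x)} (\<lambda>u. (Li (min u (x / u)) - Li (u / r)) / ln u)"

lemma main_integrable:
  assumes "1 < r"
  shows "(\<lambda>u. (Li (min u (x / u)) - Li (u / r)) / ln u) integrable_on {2..b}"
  using assms
  by (intro integrable_continuous_real continuous_intros continuous_on_compose2[OF continuous_on_Li[of UNIV]])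
     auto

text \<open>Density of the measure \<open>du dv / (ln u ln v)\<close> in the coordinates \<open>u\<close> and \<open>t = u v\<close>.\<close>
definition kernel :: "real \<Rightarrow> real \<Rightarrow> real \<Rightarrow> real \<Rightarrow> ennreal" where
  "kernel r x u t = (if 2 \<le> u \<and> 2 * u \<le> t \<and> t \<le> u * u \<and> u * u \<le> r * t \<and> t \<le> x
     then ennreal (1 / (u * ln u * ln (t / u))) else 0)"

lemma kernel_measurable:
  "(\<lambda>(u, t). kernel r x u t) \<in> borel_measurable (lborel \<Otimes>\<^sub>M lborel)"
  unfolding kernel_def by measurable

text \<open>For fixed \<open>u\<close> the substitution \<open>t = u * v\<close> has Jacobian
  \<open>u\<close>, which cancels the factor \<open>1 / u\<close> of the kernel; the conditions on
  \<open>t\<close> become \<open>max 2 (u / r) \<le> v \<le> min u (x / u)\<close>.\<close>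

lemma nn_integral_kernel_snd:
  assumes "1 < r" "0 < x" "2 \<le> u" "u \<le> sqrt (r * x)"
  shows "(\<integral>\<^sup>+t. kernel r x u t \<partial>lborel) = ennreal ((Li (min u (x / u)) - Li (u / r)) / ln u)"
proof -
  define a b where "a = max 2 (u / r)" and "b = min u (x / u)"
  define h where "h v = (if a \<le> v \<and> v \<le> b then ennreal (1 / (ln v * ln u)) else 0)" for v
  have "u * u \<le> sqrt (r * x) * sqrt (r * x)" using assms by (intro mult_mono) auto
  then have ub: "u / r \<le> b" using assms by (auto simp: b_def field_simps)
  have ln: "0 < ln u" using assms by auto
  have "((\<lambda>t. 1 / ln t * (1 / ln u)) has_integral (integral {a..b} (\<lambda>t. 1 / ln t)) * (1 / ln u)) {a..b}"
    by (intro has_integral_mult_left integrable_integral ln_inverse_integrable) (auto simp: a_def)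
  then have *: "((\<lambda>v. 1 / (ln v * ln u)) has_integral (Li b - Li (u / r)) / ln u) {a..b}"
    using Li_diff[OF ub] by (simp add: a_def)
  have "(\<integral>\<^sup>+v. h v \<partial>lborel) = (\<integral>\<^sup>+v. ennreal (1 / (ln v * ln u)) * indicator {a..b} v \<partial>lborel)"
    by (intro nn_integral_cong) (auto simp: h_def indicator_def)
  also have "\<dots> = ennreal ((Li b - Li (u / r)) / ln u)"
    using * ln by (intro nn_integral_has_integral_lebesgue') (auto simp: a_def)
  finally have 1: "(\<integral>\<^sup>+v. h v \<partial>lborel) = ennreal ((Li b - Li (u / r)) / ln u)" .
  have hm: "h \<in> borel_measurable borel" unfolding h_def by measurable
  have hm': "(\<lambda>t. h (0 + 1 / u * t)) \<in> borel_measurable lborel"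
    unfolding h_def by measurable
  have "(\<integral>\<^sup>+v. h v \<partial>lborel) = ennreal \<bar>1 / u\<bar> * (\<integral>\<^sup>+t. h (0 + 1 / u * t) \<partial>lborel)"
    using assms by (intro nn_integral_real_affine hm) auto
  also have "\<dots> = (\<integral>\<^sup>+t. ennreal \<bar>1 / u\<bar> * h (0 + 1 / u * t) \<partial>lborel)"
    by (rule nn_integral_cmult[symmetric, OF hm'])
  also have "\<dots> = (\<integral>\<^sup>+t. kernel r x u t \<partial>lborel)"
  proof (rule nn_integral_cong)
    fix t :: real
    have iff: "a \<le> t / u \<and> t / u \<le> b \<longleftrightarrow>
       2 \<le> u \<and> 2 * u \<le> t \<and> t \<le> u * u \<and> u * u \<le> r * t \<and> t \<le> x"
      using assms by (auto simp: a_def b_def field_simps)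
    show "ennreal \<bar>1 / u\<bar> * h (0 + 1 / u * t) = kernel r x u t"
    proof (cases "a \<le> t / u \<and> t / u \<le> b")
      case True
      then have "0 \<le> ln (t / u)" by (auto simp: a_def)
      then show ?thesis
        using True iff assms ln
        by (simp add: h_def kernel_def ennreal_mult[symmetric] mult_ac)
    next
      case False
      then have "h (0 + 1 / u * t) = 0" by (auto simp: h_def)
      moreover have "kernel r x u t = 0" using False iff by (auto simp: kernel_def)
      ultimately show ?thesis by simp
    qed
  qed
  finally show ?thesis using 1 by (simp add: b_def)
qed

text \<open>Partial fractions: since \<open>ln u + ln (t / u) = ln t\<close>, the kernel is the sum
  of \<open>1 / (u * ln u)\<close> and \<open>1 / (u * ln (t / u))\<close>, divided by
  \<open>ln t\<close>. Both summands are derivatives of iterated logarithms up to sign.\<close>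

lemma kernel_antiderivative:
  fixes t u :: real
  assumes "1 < u" "u < t"
  shows "((\<lambda>u. (ln (ln u) - ln (ln (t / u))) / ln t) has_real_derivative
     1 / (u * ln u * ln (t / u))) (at u)"
proof -
  have p: "0 < ln u" "0 < ln (t / u)" "0 < ln t" using assms by auto
  have s: "ln t = ln u + ln (t / u)" using assms by (simp add: ln_div)
  have "((\<lambda>u. (ln (ln u) - ln (ln (t / u))) / ln t) has_real_derivative
     (1 / (u * ln u) + 1 / (u * ln (t / u))) / ln t) (at u)"
    using assms p by (auto intro!: derivative_eq_intros simp: field_simps)
  moreover have "(1 / (u * ln u) + 1 / (u * ln (t / u))) / ln t = 1 / (u * ln u * ln (t / u))"
    using assms p by (simp add: s divide_simps)
  ultimately show ?thesis by simp
qed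

text \<open>For \<open>4 * r \<le> t\<close> the constraints \<open>2 \<le> u\<close> and
  \<open>2 \<le> t / u\<close> follow from the others, so \<open>u\<close> runs over all of
  \<open>{sqrt t..sqrt (r * t)}\<close>. The antiderivative vanishes at the lower end, where
  \<open>u = t / u\<close>, and yields the integrand of \<open>F\<close> at the upper end.\<close>

lemma nn_integral_kernel_fst:
  assumes "1 < r" "4 * r \<le> t" "t \<le> x"
  shows "(\<integral>\<^sup>+u. kernel r x u t \<partial>lborel) = ennreal (F_integrand r t)"
proof -
  have t: "4 < t" "0 < r" using assms by auto
  define \<Phi> where "\<Phi> u = (ln (ln u) - ln (ln (t / u))) / ln t" for u
  have s2: "2 \<le> sqrt t" using t by (intro real_le_rsqrt) auto
  \<comment> \<open>The hypothesis \<open>4 * r \<le> t\<close> is equivalent to this inequality,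
    which says that \<open>t / u\<close> is still at least 2 at the upper end.\<close>
  have "r * t \<le> (t / 2)\<^sup>2"
    using assms t mult_right_mono[of "4 * r" t t] by (simp add: power2_eq_square)
  then have st: "sqrt (r * t) \<le> t / 2" using t by (intro real_le_lsqrt) auto
  have "t \<le> r * t" using assms t by simp
  then have le: "sqrt t \<le> sqrt (r * t)" by simp
  have iff: "2 \<le> u \<and> 2 * u \<le> t \<and> t \<le> u * u \<and> u * u \<le> r * t \<and> t \<le> x \<longleftrightarrow> u \<in> {sqrt t..sqrt (r * t)}" for u
  proof
    assume "2 \<le> u \<and> 2 * u \<le> t \<and> t \<le> u * u \<and> u * u \<le> r * t \<and> t \<le> x"
    then show "u \<in> {sqrt t..sqrt (r * t)}"
      by (auto intro!: real_le_lsqrt real_le_rsqrt simp: power2_eq_square)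
  next
    assume u: "u \<in> {sqrt t..sqrt (r * t)}"
    have "sqrt t * sqrt t \<le> u * u" using u s2 t by (intro mult_mono) auto
    moreover have "u * u \<le> sqrt (r * t) * sqrt (r * t)" using u s2 t by (intro mult_mono) auto
    ultimately have "t \<le> u * u" "u * u \<le> r * t" using t by simp_all
    then show "2 \<le> u \<and> 2 * u \<le> t \<and> t \<le> u * u \<and> u * u \<le> r * t \<and> t \<le> x"
      using u s2 st assms by simp
  qed
  have "((\<lambda>u. 1 / (u * ln u * ln (t / u))) has_integral (\<Phi> (sqrt (r * t)) - \<Phi> (sqrt t)))
      {sqrt t..sqrt (r * t)}"
  proof (rule fundamental_theorem_of_calculus[OF le])
    fix u assume "u \<in> {sqrt t..sqrt (r * t)}"
    then have "1 < u" "u < t" using s2 st t by auto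
    then have "(\<Phi> has_vector_derivative 1 / (u * ln u * ln (t / u))) (at u)"
      unfolding \<Phi>_def has_real_derivative_iff_has_vector_derivative[symmetric]
      by (rule kernel_antiderivative)
    then show "(\<Phi> has_vector_derivative 1 / (u * ln u * ln (t / u))) (at u within {sqrt t..sqrt (r * t)})"
      by (rule has_vector_derivative_at_within)
  qed
  moreover have "\<Phi> (sqrt (r * t)) - \<Phi> (sqrt t) = F_integrand r t"
  proof -
    have "t / sqrt t = sqrt t" using t by (simp add: real_div_sqrt)
    moreover from this have "t / sqrt (r * t) = sqrt (t / r)"
      unfolding real_sqrt_mult real_sqrt_divide by (metis divide_divide_eq_left')
    ultimately show ?thesis by (simp add: \<Phi>_def F_integrand_def)
  qed
  ultimately have *: "((\<lambda>u. 1 / (u * ln u * ln (t / u))) has_integral F_integrand r t) {sqrt t..sqrt (r * t)}"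
    by simp
  have "(\<integral>\<^sup>+u. kernel r x u t \<partial>lborel)
      = (\<integral>\<^sup>+u. ennreal (1 / (u * ln u * ln (t / u))) * indicator {sqrt t..sqrt (r * t)} u \<partial>lborel)"
    by (intro nn_integral_cong) (simp add: kernel_def iff indicator_def)
  also have "\<dots> = ennreal (F_integrand r t)"
    using * s2 st t by (intro nn_integral_has_integral_lebesgue') auto
  finally show ?thesis .
qed

text \<open>A crude bound for all \<open>t\<close>, applied for \<open>t\<close> up to
  \<open>4 * r\<close>, where the cut-offs at 2 may shorten the range of \<open>u\<close>. The
  kernel is at most \<open>1 / (sqrt t * (ln 2)\<^sup>2)\<close> and is supported in an interval of
  length \<open>sqrt (r * t)\<close>.\<close>

lemma nn_integral_kernel_fst_le:
  assumes "1 < r"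
  shows "(\<integral>\<^sup>+u. kernel r x u t \<partial>lborel) \<le> ennreal (sqrt r / (ln 2)\<^sup>2)"
proof (cases "4 \<le> t")
  case False
  \<comment> \<open>The conditions \<open>2 \<le> u\<close> and \<open>2 * u \<le> t\<close> force
    \<open>4 \<le> t\<close>.\<close>
  then have "kernel r x u t = 0" for u by (auto simp: kernel_def)
  then show ?thesis by simp
next
  case True
  have "(\<integral>\<^sup>+u. kernel r x u t \<partial>lborel)
      \<le> (\<integral>\<^sup>+u. ennreal (1 / (sqrt t * (ln 2)\<^sup>2)) * indicator {0..sqrt (r * t)} u \<partial>lborel)"
  proof (rule nn_integral_mono)
    fix u
    show "kernel r x u t \<le> ennreal (1 / (sqrt t * (ln 2)\<^sup>2)) * indicator {0..sqrt (r * t)} u"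
    proof (cases "2 \<le> u \<and> 2 * u \<le> t \<and> t \<le> u * u \<and> u * u \<le> r * t \<and> t \<le> x")
      case u: True
      have "2 \<le> t / u" using u by (simp add: field_simps)
      then have l: "ln 2 \<le> ln (t / u)" "ln 2 \<le> ln u" using u by auto
      have "sqrt t \<le> u" using u by (auto intro!: real_le_lsqrt simp: power2_eq_square)
      then have "sqrt t * ln 2 * ln 2 \<le> u * ln u * ln (t / u)"
        using l u by (intro mult_mono) auto
      then have "1 / (u * ln u * ln (t / u)) \<le> 1 / (sqrt t * (ln 2)\<^sup>2)"
        using True l u by (intro divide_left_mono) (auto simp: power2_eq_square mult.assoc)
      moreover have "u \<in> {0..sqrt (r * t)}"
        using u by (auto intro!: real_le_rsqrt simp: power2_eq_square)
      ultimately show ?thesis using u by (simp add: kernel_def ennreal_leI)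
    next
      case False
      then show ?thesis unfolding kernel_def by (simp only: if_False) simp
    qed
  qed
  also have "\<dots> = ennreal (1 / (sqrt t * (ln 2)\<^sup>2)) * ennreal (sqrt (r * t))"
    using True assms by (simp add: nn_integral_cmult_indicator)
  also have "\<dots> = ennreal (sqrt r / (ln 2)\<^sup>2)"
    using True assms by (simp add: ennreal_mult[symmetric] real_sqrt_mult)
  finally show ?thesis .
qed

text \<open>Tonelli for the nonnegative kernel, which vanishes for \<open>u\<close> outside
  \<open>{2..sqrt (r * x)}\<close>. Nonnegativity of the main integral serves the return from
  \<open>ennreal\<close> to real inequalities.\<close>

lemma main_integral_nn:
  assumes "1 < r" "4 * r \<le> x"
  shows "ennreal (main_integral r x) = (\<integral>\<^sup>+t. (\<integral>\<^sup>+u. kernel r x u t \<partial>lborel) \<partial>lborel)"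
    "0 \<le> main_integral r x"
proof -
  have x: "0 < x" using assms by auto
  let ?f = "\<lambda>u. (Li (min u (x / u)) - Li (u / r)) / ln u"
  have nonneg: "0 \<le> ?f u" if "u \<in> {2..sqrt (r * x)}" for u
  proof -
    have "u * u \<le> sqrt (r * x) * sqrt (r * x)" using that assms by (intro mult_mono) auto
    then have "u / r \<le> min u (x / u)" using assms that x by (auto simp: field_simps)
    then show ?thesis using Li_diff_bounds(1)[of "u / r" "min u (x / u)"] that by auto
  qed
  have hi: "(?f has_integral main_integral r x) {2..sqrt (r * x)}"
    unfolding main_integral_def by (intro integrable_integral main_integrable assms)
  then show "0 \<le> main_integral r x" using nonneg has_integral_nonneg by blast
  have "(\<integral>\<^sup>+t. (\<integral>\<^sup>+u. kernel r x u t \<partial>lborel) \<partial>lborel)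
      = (\<integral>\<^sup>+u. (\<integral>\<^sup>+t. kernel r x u t \<partial>lborel) \<partial>lborel)"
    by (rule lborel_pair.Fubini'[OF kernel_measurable])
  also have "\<dots> = (\<integral>\<^sup>+u. ennreal (?f u) * indicator {2..sqrt (r * x)} u \<partial>lborel)"
  proof (rule nn_integral_cong)
    fix u
    show "(\<integral>\<^sup>+t. kernel r x u t \<partial>lborel) = ennreal (?f u) * indicator {2..sqrt (r * x)} u"
    proof (cases "u \<in> {2..sqrt (r * x)}")
      case True
      then show ?thesis using nn_integral_kernel_snd[of r x u] assms x by simp
    next
      case False
      have "kernel r x u t = 0" for t
      proof -
        have "\<not> (2 \<le> u \<and> u * u \<le> r * t \<and> t \<le> x)"
        proof
          assume *: "2 \<le> u \<and> u * u \<le> r * t \<and> t \<le> x"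
          then have "r * t \<le> r * x" using assms by (intro mult_left_mono) auto
          then have "u \<le> sqrt (r * x)" using * by (intro real_le_rsqrt) (auto simp: power2_eq_square)
          then show False using False * by auto
        qed
        then show ?thesis by (auto simp: kernel_def)
      qed
      then show ?thesis using False by simp
    qed
  qed
  also have "\<dots> = ennreal (main_integral r x)"
    using hi nonneg by (intro nn_integral_has_integral_lebesgue') auto
  finally show "ennreal (main_integral r x) = (\<integral>\<^sup>+t. (\<integral>\<^sup>+u. kernel r x u t \<partial>lborel) \<partial>lborel)" ..
qed

text \<open>For \<open>t\<close> in \<open>{4 * r..x}\<close> the inner integral is exactly the
  integrand of \<open>F\<close>; the remaining \<open>t\<close> contribute at least 0 and at most
  \<open>4 * r\<close> times the crude bound.\<close>

lemma main_integral_bounds: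
  assumes "1 < r" "4 * r \<le> x"
  defines "J \<equiv> integral {4 * r..x} (F_integrand r)"
  shows "J \<le> main_integral r x" "main_integral r x \<le> J + 4 * r * sqrt r / (ln 2)\<^sup>2"
proof -
  let ?I = "\<lambda>t. \<integral>\<^sup>+u. kernel r x u t \<partial>lborel"
  have hi: "(F_integrand r has_integral J) {4 * r..x}"
    unfolding J_def using assms by (intro integrable_integral F_integrand_integrable) auto
  have J0: "0 \<le> J" unfolding J_def using assms by (intro F_integrand_integral_bounds) auto
  have J: "(\<integral>\<^sup>+t. ennreal (F_integrand r t) * indicator {4 * r..x} t \<partial>lborel) = ennreal J"
    using hi F_integrand_bounds[of r] assms by (intro nn_integral_has_integral_lebesgue') auto
  have "ennreal J \<le> (\<integral>\<^sup>+t. ?I t \<partial>lborel)"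
    unfolding J[symmetric]
  proof (rule nn_integral_mono)
    fix t show "ennreal (F_integrand r t) * indicator {4 * r..x} t \<le> ?I t"
      using nn_integral_kernel_fst[of r t x] assms by (cases "t \<in> {4 * r..x}") auto
  qed
  then have "ennreal J \<le> ennreal (main_integral r x)"
    using main_integral_nn[of r x] assms by simp
  then show "J \<le> main_integral r x"
    using main_integral_nn(2)[of r x] assms by (simp add: ennreal_le_iff)
  have m: "F_integrand r \<in> borel_measurable borel" unfolding F_integrand_def by measurable
  have "ennreal (main_integral r x) = (\<integral>\<^sup>+t. ?I t \<partial>lborel)"
    using main_integral_nn[of r x] assms by simp
  also have "\<dots> \<le> (\<integral>\<^sup>+t. ennreal (F_integrand r t) * indicator {4 * r..x} t
      + ennreal (sqrt r / (ln 2)\<^sup>2) * indicator {0..4 * r} t \<partial>lborel)"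
  proof (rule nn_integral_mono)
    fix t
    consider "t \<in> {4 * r..x}" | "t \<in> {0..4 * r}" | "t < 0 \<or> x < t" using assms by fastforce
    then show "?I t \<le> ennreal (F_integrand r t) * indicator {4 * r..x} t
      + ennreal (sqrt r / (ln 2)\<^sup>2) * indicator {0..4 * r} t"
    proof cases
      case 1
      then show ?thesis using nn_integral_kernel_fst[of r t x] assms by auto
    next
      case 2
      then show ?thesis using nn_integral_kernel_fst_le[of r x t] assms
        by (simp add: add_increasing)
    next
      case 3
      then have "kernel r x u t = 0" for u by (auto simp: kernel_def)
      then show ?thesis by simp
    qed
  qed
  also have "\<dots> = ennreal J + (\<integral>\<^sup>+t. ennreal (sqrt r / (ln 2)\<^sup>2) * indicator {0..4 * r} t \<partial>lborel)"
    unfolding J[symmetric] using m by (intro nn_integral_add) auto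
  also have "\<dots> = ennreal J + ennreal (sqrt r / (ln 2)\<^sup>2) * ennreal (4 * r)"
    using assms by (simp add: nn_integral_cmult_indicator)
  also have "\<dots> = ennreal (J + sqrt r / (ln 2)\<^sup>2 * (4 * r))"
    using assms J0 by (simp add: ennreal_mult[symmetric] ennreal_plus[symmetric] del: ennreal_plus)
  finally show "main_integral r x \<le> J + 4 * r * sqrt r / (ln 2)\<^sup>2"
    using assms J0 by (subst (asm) ennreal_le_iff) (auto simp: mult_ac)
qed

section \<open>Collecting the error terms\<close>

text \<open>The constant is chosen before \<open>r\<close> and \<open>x\<close>, so the bound is
  uniform in both.\<close>

theorem theorem2:
  fixes S1 S2 :: "nat set" and \<delta>1 \<delta>2 c \<epsilon> :: real
  assumes "S1 \<subseteq> {p. prime p}" and "S2 \<subseteq> {p. prime p}"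
    and "\<delta>1 > 0" and "\<delta>2 > 0" and "c > 0"
    and "(\<lambda>x. real (prime_count S1 x) - 1 / \<delta>1 * Li x) \<in> O[at_top](\<lambda>x. x * exp (- c * sqrt (ln x)))"
    and "(\<lambda>x. real (prime_count S2 x) - 1 / \<delta>2 * Li x) \<in> O[at_top](\<lambda>x. x * exp (- c * sqrt (ln x)))"
    and "0 < \<epsilon>" and "\<epsilon> < 1"
  shows "\<exists>C. \<forall>r>1. \<forall>x\<ge>2 * r.
    \<bar>\<delta>1 * \<delta>2 * real (D S1 S2 r x) - F r x\<bar>
      \<le> C * (r * x * exp (- ((1 - \<epsilon>) * c / sqrt 2) * sqrt (ln x)))"
proof -
  define g where "g Y = Y * exp (- c * sqrt (ln Y))" for Y :: real
  define A where "A = exp (c\<^sup>2 / 4)"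
  define B where "B = F_integrand_bound"
  obtain C1 where C1: "0 \<le> C1" "\<And>y Y. 0 \<le> y \<Longrightarrow> y \<le> Y \<Longrightarrow> 1 \<le> Y \<Longrightarrow>
       \<bar>\<delta>1 * real (prime_count S1 y) - Li y\<bar> \<le> C1 * g Y"
    using prime_count_uniform_bound[OF assms(6,3)] unfolding g_def by metis
  obtain C2 where C2: "0 \<le> C2" "\<And>y Y. 0 \<le> y \<Longrightarrow> y \<le> Y \<Longrightarrow> 1 \<le> Y \<Longrightarrow>
       \<bar>\<delta>2 * real (prime_count S2 y) - Li y\<bar> \<le> C2 * g Y"
    using prime_count_uniform_bound[OF assms(7,4)] unfolding g_def by metis
  have B: "0 \<le> B" using F_integrand_bounds[of 2 4] by (simp add: B_def)
  have A: "0 < A" by (simp add: A_def)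
  \<comment> \<open>The summands correspond in order to the estimates \<open>1\<close>,
    \<open>2\<close> and \<open>3\<close> for \<open>4 * r \<le> x\<close> and to the trivial
    estimate for \<open>x < 4 * r\<close>.\<close>
  define K where "K = 2 * \<delta>1 * C2 + (\<delta>1 * A + 2 * C1) / ln 2 + (4 / (ln 2)\<^sup>2 + 2 * B) * A
    + (\<delta>1 * \<delta>2 + B) * 2 * A"
  have K0: "0 \<le> K" using A B C1 C2 assms by (auto simp: K_def)
  have "\<bar>\<delta>1 * \<delta>2 * real (D S1 S2 r x) - F r x\<bar> \<le> K * (r * sqrt x * g (sqrt x))"
    if rx: "1 < r" "2 * r \<le> x" for r x
  proof -
    define G where "G = g (sqrt x)"
    define T where "T = r * sqrt x * G"
    have x: "2 < x" "r < x" using rx by auto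
    have sx: "1 \<le> sqrt x" using x by simp
    \<comment> \<open>Quasi-monotonicity from the argument 1; it absorbs contributions without
      exponential decay into \<open>T\<close> at the cost of a factor \<open>A\<close>.\<close>
    have AG: "1 \<le> A * G"
      using error_term_quasi_mono[of 1 "sqrt x" c] sx by (simp add: A_def G_def g_def)
    have G: "0 < G" using x by (simp add: G_def g_def)
    have small: "r * sqrt x \<le> A * T"
      using AG rx x mult_left_mono[of 1 "A * G" "r * sqrt x"] by (simp add: T_def mult_ac)
    have T0: "0 < T" using rx x G by (simp add: T_def)
    have sr: "sqrt r \<le> r" using rx by (intro real_le_lsqrt) (auto simp: power2_eq_square)
    have srx: "sqrt (r * x) \<le> r * sqrt x" using sr x by (simp add: real_sqrt_mult mult_right_mono)
    show ?thesis
    proof (cases "4 * r \<le> x")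
      \<comment> \<open>Here \<open>D\<close> and \<open>F\<close> are both at most a constant times
        \<open>x\<close>, and \<open>sqrt x \<le> 2 * r\<close> bounds \<open>x\<close> by
        \<open>2 * r * sqrt x\<close>.\<close>
      case False
      have "\<bar>\<delta>1 * \<delta>2 * real (D S1 S2 r x) - F r x\<bar> \<le> (\<delta>1 * \<delta>2 + B) * x"
      proof -
        have "\<delta>1 * \<delta>2 * real (D S1 S2 r x) \<le> \<delta>1 * \<delta>2 * x"
          using D_le[of x S1 S2 r] x assms by (intro mult_left_mono) auto
        moreover have "0 \<le> \<delta>1 * \<delta>2 * real (D S1 S2 r x)" using assms by simp
        moreover have "0 \<le> F r x" "F r x \<le> B * (x - 2 * r)"
          using F_integrand_integral_bounds[of r "2 * r" x] rx by (auto simp: F_eq B_def)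
        moreover have "B * (x - 2 * r) \<le> B * x" using B rx by (intro mult_left_mono) auto
        moreover have "0 \<le> \<delta>1 * \<delta>2 * x" "0 \<le> B * x" using B x assms by auto
        ultimately show ?thesis by (simp add: distrib_right)
      qed
      also have "x \<le> 2 * (r * sqrt x)"
      proof -
        have "sqrt x \<le> sqrt (4 * r)" using False by simp
        then have "sqrt x \<le> 2 * r" using sr by (simp add: real_sqrt_mult)
        then have "sqrt x * sqrt x \<le> 2 * r * sqrt x" using x by (intro mult_right_mono) auto
        then show ?thesis using x by simp
      qed
      also have "\<dots> \<le> 2 * (A * T)" using small by simp
      finally have "\<bar>\<delta>1 * \<delta>2 * real (D S1 S2 r x) - F r x\<bar> \<le> (\<delta>1 * \<delta>2 + B) * (2 * (A * T))"
        using assms B by (auto simp: mult_left_mono)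
      also have "\<dots> \<le> K * T"
      proof -
        have "(\<delta>1 * \<delta>2 + B) * 2 * A \<le> K" using A B C1 C2 assms by (auto simp: K_def)
        then show ?thesis using T0 mult_right_mono[of "(\<delta>1 * \<delta>2 + B) * 2 * A" K T]
          by (simp add: mult_ac)
      qed
      finally show ?thesis by (simp add: T_def G_def)
    next
      case True
      define P where "P = {p. real p \<le> sqrt x \<and> prime p \<and> p \<in> S1}"
      define m where "m p = min (r * real p) (x / real p)" for p :: nat
      define \<Sigma> where "\<Sigma> = (\<Sum>p\<in>P. Li (m p) - Li (real p))"
      have cP: "real (card P) \<le> sqrt x"
        unfolding P_def using x by (intro card_pos_real_le) (auto simp: prime_gt_0_nat)
      have s1: "1 \<le> sqrt (r * x)" "sqrt x \<le> sqrt (r * x)" using rx x by (auto simp: less_1_mult less_imp_le)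
      \<comment> \<open>Only the exponential is compared with its value at \<open>sqrt x\<close>;
        the factor \<open>sqrt (r * x)\<close> supplies \<open>sqrt r\<close>.\<close>
      have gr: "g (sqrt (r * x)) \<le> sqrt r * G"
      proof -
        have "ln (sqrt x) \<le> ln (sqrt (r * x))" using s1 x rx by (subst ln_le_cancel_iff) auto
        then have "exp (- c * sqrt (ln (sqrt (r * x)))) \<le> exp (- c * sqrt (ln (sqrt x)))"
          using assms by simp
        then have "sqrt (r * x) * exp (- c * sqrt (ln (sqrt (r * x))))
            \<le> sqrt (r * x) * exp (- c * sqrt (ln (sqrt x)))"
          using rx x by (intro mult_left_mono) auto
        then show ?thesis by (simp add: g_def G_def real_sqrt_mult mult.assoc)
      qed
      \<comment> \<open>Replacing the prime counts of \<open>S2\<close> by \<open>Li\<close>: at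
        most \<open>sqrt x\<close> values of \<open>p\<close>, each with two arguments not exceeding
        \<open>sqrt (r * x)\<close>.\<close>
      have 1: "\<bar>\<delta>1 * \<delta>2 * real (D S1 S2 r x) - \<delta>1 * \<Sigma>\<bar> \<le> 2 * \<delta>1 * C2 * T"
      proof -
        have t: "\<bar>\<delta>2 * (real (prime_count S2 (m p)) - real (prime_count S2 (real p))) - (Li (m p) - Li (real p))\<bar>
            \<le> 2 * (C2 * (sqrt r * G))" if "p \<in> P" for p
        proof -
          have p: "0 < real p" "real p \<le> sqrt x" using that by (auto simp: P_def prime_gt_0_nat)
          have "m p \<le> sqrt (r * x)"
          proof (rule real_le_rsqrt)
            have "m p * m p \<le> (r * real p) * (x / real p)"
              using p rx x by (intro mult_mono) (auto simp: m_def)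
            then show "(m p)\<^sup>2 \<le> r * x" using p by (simp add: power2_eq_square)
          qed
          moreover have "0 \<le> m p" using p rx x by (auto simp: m_def)
          ultimately have "\<bar>\<delta>2 * real (prime_count S2 (m p)) - Li (m p)\<bar> \<le> C2 * g (sqrt (r * x))"
            "\<bar>\<delta>2 * real (prime_count S2 (real p)) - Li (real p)\<bar> \<le> C2 * g (sqrt (r * x))"
            using p s1(1) order_trans[OF p(2) s1(2)] by (auto intro!: C2(2))
          moreover have "C2 * g (sqrt (r * x)) \<le> C2 * (sqrt r * G)"
            using gr C2(1) by (rule mult_left_mono)
          ultimately show ?thesis unfolding right_diff_distrib by linarith
        qed
        have "\<delta>2 * real (D S1 S2 r x) - \<Sigma> = (\<Sum>p\<in>P. \<delta>2 * (real (prime_count S2 (m p))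
            - real (prime_count S2 (real p))) - (Li (m p) - Li (real p)))"
          using D_eq_sum_prime_count[of r x S1 S2] rx x
          by (simp add: \<Sigma>_def P_def m_def sum_subtractf sum_distrib_left right_diff_distrib)
        also have "\<bar>\<dots>\<bar> \<le> (\<Sum>p\<in>P. 2 * (C2 * (sqrt r * G)))"
          using t by (intro order_trans[OF sum_abs] sum_mono)
        also have "\<dots> = real (card P) * (2 * (C2 * (sqrt r * G)))" by simp
        also have "\<dots> \<le> sqrt x * (2 * (C2 * (r * G)))"
          using cP sr C2(1) G rx x by (intro mult_mono) auto
        also have "\<dots> = 2 * C2 * T" by (simp add: T_def mult_ac)
        finally have "\<delta>1 * \<bar>\<delta>2 * real (D S1 S2 r x) - \<Sigma>\<bar> \<le> \<delta>1 * (2 * C2 * T)"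
          using assms by (intro mult_left_mono) auto
        moreover have "\<delta>1 * \<bar>\<delta>2 * real (D S1 S2 r x) - \<Sigma>\<bar>
            = \<bar>\<delta>1 * \<delta>2 * real (D S1 S2 r x) - \<delta>1 * \<Sigma>\<bar>"
          using assms by (simp add: abs_mult_pos' right_diff_distrib mult.assoc)
        ultimately show ?thesis by (simp add: mult_ac)
      qed
      \<comment> \<open>Replacing the prime counts of \<open>S1\<close> by \<open>Li\<close> under
        the integral: at each \<open>u\<close> the window count costs \<open>\<delta>1\<close>, and
        two prime counts at arguments up to \<open>sqrt x\<close> cost \<open>C1 * G\<close> each.
        The interval has length at most \<open>r * sqrt x\<close>.\<close>
      have 2: "\<bar>\<delta>1 * \<Sigma> - main_integral r x\<bar> \<le> (\<delta>1 * A + 2 * C1) / ln 2 * T"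
      proof -
        let ?n = "\<lambda>u. real (card {p\<in>P. real p \<le> u \<and> u \<le> m p})"
        let ?l = "\<lambda>u. Li (min u (x / u)) - Li (u / r)"
        have "((\<lambda>u. ?n u / ln u) has_integral \<Sigma>) {2..sqrt (r * x)}"
          using sum_Li_eq_integral[of r x S1] rx x unfolding \<Sigma>_def P_def m_def by simp
        then have "((\<lambda>u. \<delta>1 * (?n u / ln u) - ?l u / ln u) has_integral
            \<delta>1 * \<Sigma> - main_integral r x) {2..sqrt (r * x)}"
          unfolding main_integral_def
          by (intro has_integral_diff has_integral_mult_right integrable_integral main_integrable rx)
        moreover have "norm (\<delta>1 * (?n u / ln u) - ?l u / ln u) \<le> (\<delta>1 + 2 * (C1 * G)) / ln 2"
          if u: "u \<in> {2..sqrt (r * x)}" for u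
        proof -
          have "u * u \<le> sqrt (r * x) * sqrt (r * x)" using u rx x by (intro mult_mono) auto
          then have ur: "u / r * (u / r) \<le> x / r" "u * u \<le> r * x" using u rx x by (auto simp: field_simps)
          have "x / r \<le> x" using rx x by (simp add: field_simps)
          then have a: "u / r \<le> sqrt x" using ur by (intro real_le_rsqrt) (auto simp: power2_eq_square)
          have b: "min u (x / u) \<le> sqrt x"
          proof (rule real_le_rsqrt)
            have "min u (x / u) * min u (x / u) \<le> u * (x / u)"
              using u x by (intro mult_mono) auto
            then show "(min u (x / u))\<^sup>2 \<le> x" using u by (simp add: power2_eq_square)
          qed
          have e1: "\<bar>\<delta>1 * real (prime_count S1 (u / r)) - Li (u / r)\<bar> \<le> C1 * G"
            unfolding G_def using a u rx sx by (intro C1(2)) auto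
          have e2: "\<bar>\<delta>1 * real (prime_count S1 (min u (x / u))) - Li (min u (x / u))\<bar> \<le> C1 * G"
            unfolding G_def using b u x sx by (intro C1(2)) auto
          have "\<bar>?n u - (real (prime_count S1 (min u (x / u))) - real (prime_count S1 (u / r)))\<bar> \<le> 1"
            using card_window[of r x u S1] rx x u unfolding P_def m_def by simp
          then have "\<delta>1 * \<bar>?n u - (real (prime_count S1 (min u (x / u))) - real (prime_count S1 (u / r)))\<bar> \<le> \<delta>1"
            using assms by simp
          then have "\<bar>\<delta>1 * ?n u - (\<delta>1 * real (prime_count S1 (min u (x / u))) - \<delta>1 * real (prime_count S1 (u / r)))\<bar> \<le> \<delta>1"
            using assms by (simp add: abs_mult_pos' right_diff_distrib)
          then have "\<bar>\<delta>1 * ?n u - ?l u\<bar> \<le> \<delta>1 + 2 * (C1 * G)"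
            using e1 e2 by linarith
          moreover have "ln 2 \<le> ln u" using u by auto
          ultimately have "\<bar>\<delta>1 * ?n u - ?l u\<bar> / ln u \<le> (\<delta>1 + 2 * (C1 * G)) / ln 2"
            by (intro frac_le) auto
          moreover have "norm (\<delta>1 * (?n u / ln u) - ?l u / ln u) = \<bar>\<delta>1 * ?n u - ?l u\<bar> / ln u"
            using u by (simp add: diff_divide_distrib[symmetric])
          ultimately show ?thesis by simp
        qed
        ultimately have "norm (\<delta>1 * \<Sigma> - main_integral r x)
            \<le> (\<delta>1 + 2 * (C1 * G)) / ln 2 * measure lborel (cbox 2 (sqrt (r * x)))"
          using assms C1(1) G by (intro has_integral_bound) auto
        also have "\<dots> \<le> (\<delta>1 + 2 * (C1 * G)) / ln 2 * (r * sqrt x)"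
        proof (intro mult_left_mono)
          show "measure lborel (cbox 2 (sqrt (r * x))) \<le> r * sqrt x"
            using srx rx x by (cases "2 \<le> sqrt (r * x)") auto
        qed (use assms C1(1) G in auto)
        \<comment> \<open>The boundary term \<open>\<delta>1\<close> is absorbed by
          \<open>1 \<le> A * G\<close>.\<close>
        also have "\<dots> \<le> (\<delta>1 * (A * G) + 2 * (C1 * G)) / ln 2 * (r * sqrt x)"
          using AG assms rx x by (intro mult_right_mono divide_right_mono add_right_mono) auto
        also have "\<dots> = (\<delta>1 * A + 2 * C1) / ln 2 * T" by (simp add: T_def algebra_simps add_divide_distrib)
        finally show ?thesis by simp
      qed
      \<comment> \<open>\<open>F\<close> starts at \<open>2 * r\<close>, whereas the comparison with
        the main integral starts at \<open>4 * r\<close>; the gap costs at most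
        \<open>2 * B * r\<close>.\<close>
      have 3: "\<bar>main_integral r x - F r x\<bar> \<le> (4 / (ln 2)\<^sup>2 + 2 * B) * A * T"
      proof -
        define J where "J = integral {4 * r..x} (F_integrand r)"
        define J' where "J' = integral {2 * r..4 * r} (F_integrand r)"
        have "F r x = J' + J"
          unfolding F_eq J_def J'_def using rx True
          by (intro Henstock_Kurzweil_Integration.integral_combine[symmetric] F_integrand_integrable) auto
        moreover have "0 \<le> J'" "J' \<le> B * (2 * r)"
          using F_integrand_integral_bounds[of r "2 * r" "4 * r"] rx by (auto simp: J'_def B_def)
        moreover have "J \<le> main_integral r x" "main_integral r x \<le> J + 4 * r * sqrt r / (ln 2)\<^sup>2"
          unfolding J_def using main_integral_bounds[of r x] rx True by auto
        ultimately have "\<bar>main_integral r x - F r x\<bar> \<le> 4 / (ln 2)\<^sup>2 * (r * sqrt r) + 2 * B * (r * 1)"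
          using B rx by (simp add: abs_le_iff)
        also have "\<dots> \<le> 4 / (ln 2)\<^sup>2 * (r * sqrt x) + 2 * B * (r * sqrt x)"
          using rx x B sx by (intro add_mono mult_left_mono) auto
        also have "\<dots> = (4 / (ln 2)\<^sup>2 + 2 * B) * (r * sqrt x)" by (simp add: algebra_simps)
        also have "\<dots> \<le> (4 / (ln 2)\<^sup>2 + 2 * B) * (A * T)"
          using small B by (intro mult_left_mono) auto
        finally show ?thesis by (simp add: mult.assoc)
      qed
      have "\<bar>\<delta>1 * \<delta>2 * real (D S1 S2 r x) - F r x\<bar>
          \<le> 2 * \<delta>1 * C2 * T + (\<delta>1 * A + 2 * C1) / ln 2 * T + (4 / (ln 2)\<^sup>2 + 2 * B) * A * T"
        using 1 2 3 by linarith
      also have "\<dots> \<le> K * T"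
      proof -
        have "0 \<le> (\<delta>1 * \<delta>2 + B) * 2 * A * T" using assms B A T0 by auto
        then show ?thesis unfolding K_def distrib_right[of _ _ T] by linarith
      qed
      finally show ?thesis by (simp add: T_def G_def)
    qed
  qed
  moreover have "K * (r * sqrt x * g (sqrt x)) \<le> K * (r * x * exp (- ((1 - \<epsilon>) * c / sqrt 2) * sqrt (ln x)))"
    if rx: "1 < r" "2 * r \<le> x" for r x
  proof -
    have x: "2 < x" using rx by auto
    \<comment> \<open>Halving the logarithm is the source of the factor \<open>1 / sqrt 2\<close> in
      the exponent.\<close>
    have "sqrt (ln (sqrt x)) = sqrt (ln x) / sqrt 2"
      using x by (simp add: ln_sqrt real_sqrt_divide)
    then have "r * sqrt x * g (sqrt x) = r * x * exp (- (c / sqrt 2) * sqrt (ln x))"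
      using x by (simp add: g_def)
    also have "\<dots> \<le> r * x * exp (- ((1 - \<epsilon>) * c / sqrt 2) * sqrt (ln x))"
    proof -
      have "(1 - \<epsilon>) * c / sqrt 2 \<le> c / sqrt 2" using assms by (intro divide_right_mono) auto
      then have "(1 - \<epsilon>) * c / sqrt 2 * sqrt (ln x) \<le> c / sqrt 2 * sqrt (ln x)"
        using x by (intro mult_right_mono) auto
      then show ?thesis using rx x by (intro mult_left_mono) auto
    qed
    finally show ?thesis using K0 by (rule mult_left_mono)
  qed
  ultimately show ?thesis by (meson order_trans)
qed

end
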